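(* Let $\hat F(x):=P_1(x)+\delta_C(x)+\delta_{\mathcal{F}}(x)$ with $P_1$, $C$, $\mathcal{F}$ as in the context, let $\bar x\in\mathop{\rm Arg\,min}\hat F$, and let $\bar\eta$ be an exact penalty parameter of the problem $\min_{x\in\mathbb{R}^n}\hat F(x)$ (defined in the context). If $\hat F$ satisfies the KL property with exponent $\alpha\in(0,1)$ at $\bar x$, then for any $\eta>\bar\eta$, the function $$\hat F_\eta(x):=P_1(x)+\delta_C(x)+\eta\max_{i=1,\ldots,m}[g_i(x)]_+$$ satisfies the KL property with exponent $\alpha$ at $\bar x$.
   Context: Setting. $P_1:\mathbb{R}^n\to\mathbb{R}$ is convex; $C\subseteq\mathbb{R}^n$ is compact and convex; $g_1,\ldots,g_m:\mathbb{R}^n\to\mathbb{R}$ are convex; $\mathcal{F}:=\{x\in\mathbb{R}^n:g_i(x)\le 0,\ i=1,\ldots,m\}$; and $C\cap\{x\in\mathbb{R}^n:\max_{i=1,\ldots,m}g_i(x)<0\}\ne\emptyset$. Notation. $[t]_+:=\max\{t,0\}$; $\delta_D$ is the indicator function of a set $D$ ($0$ on $D$, $\infty$ off $D$); ${\rm dist}(x,D)$ is the Euclidean distance from $x$ to $D$. Exact penalty parameter. A number $\bar\eta>0$ is called an exact penalty parameter of $\min_{x\in\mathbb{R}^n}\hat F(x)$ if $\mathop{\rm Arg\,min}_{x\in\mathbb{R}^n}\hat F_\eta(x)=\mathop{\rm Arg\,min}_{x\in\mathbb{R}^n}\hat F(x)$ for all $\eta\ge\bar\eta$. KL property with exponent.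 A proper closed (lower semicontinuous) function $f:\mathbb{R}^n\to(-\infty,+\infty]$ satisfies the KL property with exponent $\alpha\in[0,1)$ at $\bar x\in{\rm dom}\,\partial f:=\{x:\partial f(x)\ne\emptyset\}$ if there exist $r\in(0,\infty]$, a neighborhood $U$ of $\bar x$ and $\rho>0$ such that, with $\phi(\varsigma)=\rho\varsigma^{1-\alpha}$, $\phi'(f(x)-f(\bar x))\,{\rm dist}(0,\partial f(x))\ge 1$ for all $x\in U$ with $f(\bar x)<f(x)<f(\bar x)+r$. Here $\partial f$ is the limiting subdifferential, which is the usual convex subdifferential when $f$ is convex. *)

theory Defs
  imports "HOL-Analysis.Analysis"
begin

text \<open>Functions with values in \<open>(-\<infinity>,+\<infinity>]\<close> are modelled as \<open>ereal\<close>-valued functions; properness excludes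
  the value \<open>-\<infinity>\<close>.\<close>

definition proper_fun :: "('a \<Rightarrow> ereal) \<Rightarrow> bool" where
  "proper_fun f \<longleftrightarrow> (\<forall>x. f x \<noteq> -\<infinity>) \<and> (\<exists>x. f x < \<infinity>)"

definition lower_semicontinuous :: "('a::topological_space \<Rightarrow> ereal) \<Rightarrow> bool" where
  "lower_semicontinuous f \<longleftrightarrow> (\<forall>x. f x \<le> Liminf (at x) f)"

definition delta_fun :: "'a set \<Rightarrow> 'a \<Rightarrow> ereal" where
  "delta_fun D x = (if x \<in> D then 0 else \<infinity>)"

definition Arg_min :: "('a \<Rightarrow> ereal) \<Rightarrow> 'a set" where
  "Arg_min f = {x. is_arg_min f (\<lambda>_. True) x}"

text \<open>The regular (Frechet) subdifferential, and the limiting (Mordukhovich) subdifferential obtained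
  from it by \<open>f\<close>-attentive limits. Both are empty off \<open>{x. \<bar>f x\<bar> \<noteq> \<infinity>}\<close>.\<close>

definition regular_subdiff :: "('a::real_inner \<Rightarrow> ereal) \<Rightarrow> 'a \<Rightarrow> 'a set" where
  "regular_subdiff f x = {v. \<bar>f x\<bar> \<noteq> \<infinity> \<and>
     0 \<le> Liminf (at x) (\<lambda>z. (f z - f x - ereal (v \<bullet> (z - x))) / ereal (norm (z - x)))}"

definition limiting_subdiff :: "('a::real_inner \<Rightarrow> ereal) \<Rightarrow> 'a \<Rightarrow> 'a set" where
  "limiting_subdiff f x = {v. \<bar>f x\<bar> \<noteq> \<infinity> \<and>
     (\<exists>(X :: nat \<Rightarrow> 'a) (V :: nat \<Rightarrow> 'a). X \<longlonglongrightarrow> x \<and> (\<lambda>k. f (X k)) \<longlonglongrightarrow> f x \<and>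
        (\<forall>k. V k \<in> regular_subdiff f (X k)) \<and> V \<longlonglongrightarrow> v)}"

definition dom_subdiff :: "('a::real_inner \<Rightarrow> ereal) \<Rightarrow> 'a set" where
  "dom_subdiff f = {x. limiting_subdiff f x \<noteq> {}}"

text \<open>Distance to a set with the convention that the distance to the empty set is \<open>\<infinity>\<close>
  (whereas \<open>infdist x {} = 0\<close>).\<close>

definition edist_set :: "'a::metric_space \<Rightarrow> 'a set \<Rightarrow> ereal" where
  "edist_set x D = (INF y\<in>D. ereal (dist x y))"

definition KL_exponent :: "('a::real_inner \<Rightarrow> ereal) \<Rightarrow> real \<Rightarrow> 'a \<Rightarrow> bool" where
  "KL_exponent f \<alpha> xbar \<longleftrightarrow>
     proper_fun f \<and> lower_semicontinuous f \<and> 0 \<le> \<alpha> \<and> \<alpha> < 1 \<and> xbar \<in> dom_subdiff f \<and>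
     (\<exists>(r::ereal) U (\<rho>::real). 0 < r \<and> xbar \<in> interior U \<and> 0 < \<rho> \<and>
        (\<forall>x\<in>U. f xbar < f x \<and> f x < f xbar + r \<longrightarrow>
           1 \<le> ereal (deriv (\<lambda>s. \<rho> * s powr (1 - \<alpha>)) (real_of_ereal (f x - f xbar)))
               * edist_set 0 (limiting_subdiff f x)))"

definition exact_penalty_parameter :: "('a \<Rightarrow> ereal) \<Rightarrow> (real \<Rightarrow> 'a \<Rightarrow> ereal) \<Rightarrow> real \<Rightarrow> bool" where
  "exact_penalty_parameter F Fpen \<eta>bar \<longleftrightarrow>
     0 < \<eta>bar \<and> (\<forall>\<eta>\<ge>\<eta>bar. Arg_min (Fpen \<eta>) = Arg_min F)"

definition feasible_set :: "(nat \<Rightarrow> 'a \<Rightarrow> real) \<Rightarrow> nat \<Rightarrow> 'a set" where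
  "feasible_set g m = {x. \<forall>i\<in>{1..m}. g i x \<le> 0}"

definition Fhat :: "('a \<Rightarrow> real) \<Rightarrow> 'a set \<Rightarrow> (nat \<Rightarrow> 'a \<Rightarrow> real) \<Rightarrow> nat \<Rightarrow> 'a \<Rightarrow> ereal" where
  "Fhat P1 C g m x = ereal (P1 x) + delta_fun C x + delta_fun (feasible_set g m) x"

definition Fhat_pen ::
  "('a \<Rightarrow> real) \<Rightarrow> 'a set \<Rightarrow> (nat \<Rightarrow> 'a \<Rightarrow> real) \<Rightarrow> nat \<Rightarrow> real \<Rightarrow> 'a \<Rightarrow> ereal" where
  "Fhat_pen P1 C g m \<eta> x =
     ereal (P1 x) + delta_fun C x + ereal (\<eta> * Max ((\<lambda>i. max (g i x) 0) ` {1..m}))"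

end

theory Submission
  imports Defs
begin

text \<open>For convex functions, the KL property with exponent \<open>\<alpha>\<close> at a minimiser is equivalent to a local
  error bound: the distance from \<open>x\<close> to the solution set is at most a constant times the power
  \<open>1 - \<alpha>\<close> of the excess of the objective over its minimum. Error bounds, unlike subgradient
  inequalities, are easily carried from the constrained to the penalised problem.

  The step from KL to the error bound (\<open>KL_imp_growth\<close>) is variational. Minimising the desingularised
  objective plus a small multiple of the distance from \<open>x\<close> gives a point that must be a solution:
  elsewhere it would have a subgradient shorter than KL permits (\<open>subgradient_of_cone_minorant\<close>).
  The converse (\<open>growth_imp_KL\<close>) is the subgradient inequality at a nearby solution.

  To carry the error bound over (\<open>growth_penalty\<close>), exactness at the smaller parameter \<open>\<eta>bar\<close> shows that
  the constraint violation at \<open>x\<close> is at most the penalised excess divided by \<open>\<eta> - \<eta>bar\<close>. A Slater point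
  allows the violation to be removed by a displacement of the same order (\<open>Slater_retraction\<close>), after
  which the error bound of the constrained problem applies.

  Both objectives are a finite convex function plus the indicator of a convex compact set. For such
  functions, limiting subgradients are ordinary subgradients relative to the set
  (\<open>limiting_subdiff_convex\<close>), and the KL property becomes an inequality between real numbers
  (\<open>KL_exponent_convex_iff\<close>).\<close>

section \<open>Convex functions restricted to a convex set\<close>

definition convex_subdiff_on :: "'a::real_inner set \<Rightarrow> ('a \<Rightarrow> real) \<Rightarrow> 'a \<Rightarrow> 'a set" where
  "convex_subdiff_on K P x = {v. \<forall>w\<in>K. P x + v \<bullet> (w - x) \<le> P w}"

abbreviation restrict_to :: "('a \<Rightarrow> real) \<Rightarrow> 'a set \<Rightarrow> 'a \<Rightarrow> ereal" where
  "restrict_to P K \<equiv> \<lambda>x. ereal (P x) + delta_fun K x"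

lemma restrict_to_in [simp]: "x \<in> K \<Longrightarrow> restrict_to P K x = ereal (P x)"
  by (simp add: delta_fun_def)

lemma restrict_to_notin [simp]: "x \<notin> K \<Longrightarrow> restrict_to P K x = \<infinity>"
  by (simp add: delta_fun_def)

lemma convex_on_along_segment:
  fixes P :: "'a::real_vector \<Rightarrow> real"
  assumes "convex_on K P" "x \<in> K" "w \<in> K" "0 \<le> t" "t \<le> 1"
  shows "x + t *\<^sub>R (w - x) \<in> K" "P (x + t *\<^sub>R (w - x)) \<le> P x + t * (P w - P x)"
proof -
  have eq: "x + t *\<^sub>R (w - x) = (1 - t) *\<^sub>R x + t *\<^sub>R w"
    by (simp add: algebra_simps)
  show "x + t *\<^sub>R (w - x) \<in> K"
    unfolding eq using convex_on_imp_convex[OF assms(1)] assms by (simp add: convex_alt)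
  show "P (x + t *\<^sub>R (w - x)) \<le> P x + t * (P w - P x)"
    using convex_onD[OF assms(1) assms(4,5,2,3)] unfolding eq by (simp add: algebra_simps)
qed

text \<open>A local first-order lower estimate becomes a global subgradient inequality: on the segment
  from \<open>x\<close> to \<open>w\<close>, convexity bounds the difference quotient at \<open>x\<close> of \<open>P\<close> minus the linear function \<open>v\<close> by its value at \<open>w\<close>,
  so a negative value at \<open>w\<close> would persist arbitrarily close to \<open>x\<close>.\<close>

lemma regular_subdiff_convex:
  fixes P :: "'a::real_inner \<Rightarrow> real"
  assumes P: "convex_on K P"
  shows "regular_subdiff (restrict_to P K) x = (if x \<in> K then convex_subdiff_on K P x else {})"
proof (cases "x \<in> K")
  case False
  then show ?thesis by (simp add: regular_subdiff_def)
next
  case True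
  let ?f = "restrict_to P K"
  let ?q = "\<lambda>v z. (?f z - ?f x - ereal (v \<bullet> (z - x))) / ereal (norm (z - x))"
  have q_in: "?q v z = ereal ((P z - P x - v \<bullet> (z - x)) / norm (z - x))"
    if "z \<in> K" "z \<noteq> x" for v z
    using True that by simp
  have q_out: "?q v z = \<infinity>" if "z \<notin> K" for v z
  proof -
    have "z \<noteq> x" using that True by auto
    then show ?thesis using True that by (simp add: ereal_divide)
  qed
  have sub: "v \<in> convex_subdiff_on K P x" if L: "0 \<le> Liminf (at x) (?q v)" for v
    unfolding convex_subdiff_on_def
  proof (intro CollectI ballI)
    fix w assume w: "w \<in> K"
    show "P x + v \<bullet> (w - x) \<le> P w"
    proof (rule ccontr)
      assume neg: "\<not> ?thesis"
      then have wx: "w \<noteq> x" by auto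
      define c where "c = (P w - P x - v \<bullet> (w - x)) / norm (w - x)"
      have "c < 0" using neg wx by (simp add: c_def divide_neg_pos)
      then have below: "ereal c < Liminf (at x) (?q v)"
        by (intro order_less_le_trans[OF _ L]) simp
      then obtain d where d: "d > 0" "\<And>z. z \<noteq> x \<Longrightarrow> dist z x < d \<Longrightarrow> ereal c < ?q v z"
        using less_LiminfD[OF below] by (auto simp: eventually_at)
      \<comment> \<open>Move from \<open>x\<close> towards \<open>w\<close>, just far enough to stay within distance \<open>d\<close>.\<close>
      define t where "t = min 1 (d / (2 * norm (w - x)))"
      have t: "0 < t" "t \<le> 1" using d wx by (auto simp: t_def)
      have tn: "t * norm (w - x) < d"
      proof -
        have "t * norm (w - x) \<le> d / (2 * norm (w - x)) * norm (w - x)"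
          by (intro mult_right_mono) (auto simp: t_def)
        also have "\<dots> = d / 2" using wx by simp
        finally show ?thesis using d by simp
      qed
      define z where "z = x + t *\<^sub>R (w - x)"
      have z: "z \<in> K" "P z \<le> P x + t * (P w - P x)"
        using convex_on_along_segment[OF P True w, of t] t by (auto simp: z_def)
      have zx: "z \<noteq> x" "z - x = t *\<^sub>R (w - x)" "dist z x < d"
        using t wx tn by (auto simp: z_def dist_norm)
      have "c < (P z - P x - v \<bullet> (z - x)) / norm (z - x)"
        using d(2)[OF zx(1,3)] q_in[OF z(1) zx(1)] by simp
      also have "\<dots> \<le> (t * (P w - P x - v \<bullet> (w - x))) / (t * norm (w - x))"
      proof -
        have "P z - P x - v \<bullet> (z - x) \<le> t * (P w - P x - v \<bullet> (w - x))"
          using z(2) unfolding zx(2) by (simp add: right_diff_distrib)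
        moreover have "norm (z - x) = t * norm (w - x)"
          using t unfolding zx(2) by simp
        ultimately show ?thesis
          using t by (metis divide_right_mono norm_ge_zero)
      qed
      also have "\<dots> = c" using t by (simp add: c_def)
      finally show False by simp
    qed
  qed
  have conv: "0 \<le> Liminf (at x) (?q v)" if v: "v \<in> convex_subdiff_on K P x" for v
  proof (rule Liminf_bounded)
    have "0 \<le> ?q v z" if "z \<noteq> x" for z
    proof (cases "z \<in> K")
      case True
      then show ?thesis using v that q_in[OF True that, of v]
        by (auto simp: convex_subdiff_on_def algebra_simps intro!: divide_nonneg_nonneg)
    qed (use q_out in simp)
    then show "\<forall>\<^sub>F z in at x. 0 \<le> ?q v z"
      by (simp add: eventually_at_filter)
  qed
  show ?thesis
    using sub conv True by (auto simp: regular_subdiff_def)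
qed

text \<open>Passing to limits adds nothing, because subgradient inequalities are preserved by limits of
  base points and slopes.\<close>

lemma limiting_subdiff_convex:
  fixes P :: "'a::euclidean_space \<Rightarrow> real"
  assumes P: "convex_on UNIV P" and K: "convex K"
  shows "limiting_subdiff (restrict_to P K) x = (if x \<in> K then convex_subdiff_on K P x else {})"
proof (cases "x \<in> K")
  case False
  then show ?thesis by (simp add: limiting_subdiff_def)
next
  case True
  have PK: "convex_on K P" using P K convex_on_subset by blast
  have cont: "isCont P x"
    using convex_on_continuous[OF open_UNIV P] by (simp add: continuous_on_eq_continuous_at)
  note reg = regular_subdiff_convex[OF PK]
  have sub: "v \<in> convex_subdiff_on K P x"
    if XV: "X \<longlonglongrightarrow> x" "V \<longlonglongrightarrow> v" "\<forall>k. V k \<in> regular_subdiff (restrict_to P K) (X k)"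
    for X V :: "nat \<Rightarrow> 'a" and v
    unfolding convex_subdiff_on_def
  proof (intro CollectI ballI)
    fix w assume w: "w \<in> K"
    have "(\<lambda>k. P (X k) + V k \<bullet> (w - X k)) \<longlonglongrightarrow> P x + v \<bullet> (w - x)"
      using isCont_tendsto_compose[OF cont XV(1)] XV(1,2) by (intro tendsto_intros)
    moreover have "P (X k) + V k \<bullet> (w - X k) \<le> P w" for k
      using XV(3)[rule_format, of k] w by (auto simp: reg convex_subdiff_on_def split: if_splits)
    ultimately show "P x + v \<bullet> (w - x) \<le> P w"
      by (intro LIMSEQ_le_const2) auto
  qed
  have conv: "v \<in> limiting_subdiff (restrict_to P K) x" if "v \<in> convex_subdiff_on K P x" for v
    unfolding limiting_subdiff_def
    using True that reg
    by (intro CollectI conjI exI[of _ "\<lambda>_. x"] exI[of _ "\<lambda>_. v"]) auto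
  show ?thesis
    using True conv sub by (auto simp: limiting_subdiff_def[where f = "restrict_to P K"])
qed

lemma lower_semicontinuous_restrict_to:
  fixes P :: "'a::metric_space \<Rightarrow> real"
  assumes "continuous_on UNIV P" "closed K"
  shows "lower_semicontinuous (restrict_to P K)"
  unfolding lower_semicontinuous_def
proof (intro allI le_Liminf_iff[THEN iffD2] impI)
  fix x y assume y: "y < restrict_to P K x"
  show "\<forall>\<^sub>F z in at x. y < restrict_to P K z"
  proof (cases "x \<in> K")
    case True
    have "(P \<longlongrightarrow> P x) (at x)"
      using assms(1) by (simp add: continuous_on_def)
    then have "((\<lambda>z. ereal (P z)) \<longlongrightarrow> ereal (P x)) (at x)"
      by (rule tendsto_ereal)
    then have "\<forall>\<^sub>F z in at x. y < ereal (P z)"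
      using y True by (intro order_tendstoD(1)) simp_all
    then show ?thesis
      by eventually_elim (auto simp: delta_fun_def)
  next
    case False
    then have "\<forall>\<^sub>F z in at x. z \<in> - K"
      using assms(2) by (intro eventually_at_in_open') auto
    then show ?thesis
      by eventually_elim (use y False in \<open>auto simp: delta_fun_def\<close>)
  qed
qed

section \<open>The KL inequality and local growth\<close>

definition real_KL_inequality :: "('a::real_inner \<Rightarrow> real) \<Rightarrow> 'a set \<Rightarrow> real \<Rightarrow> 'a \<Rightarrow> bool" where
  "real_KL_inequality P K \<alpha> xbar \<longleftrightarrow>
     (\<exists>\<epsilon>>0. \<exists>r>0. \<exists>c>0. \<forall>x\<in>K. dist x xbar < \<epsilon> \<longrightarrow> P xbar < P x \<longrightarrow> P x < P xbar + r \<longrightarrow>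
        (\<forall>v\<in>convex_subdiff_on K P x. c * (P x - P xbar) powr \<alpha> \<le> norm v))"

text \<open>The bound is on the distance to the level set of \<open>P xbar\<close> in \<open>K\<close>. When \<open>xbar\<close> minimises \<open>P\<close>
  over \<open>K\<close>, this is the solution set, and the property is the usual Hoelderian error bound.\<close>

definition local_growth :: "('a::metric_space \<Rightarrow> real) \<Rightarrow> 'a set \<Rightarrow> real \<Rightarrow> 'a \<Rightarrow> bool" where
  "local_growth P K \<beta> xbar \<longleftrightarrow>
     (\<exists>\<epsilon>>0. \<exists>r>0. \<exists>c>0. \<forall>x\<in>K. dist x xbar < \<epsilon> \<longrightarrow> P x < P xbar + r \<longrightarrow>
        (\<exists>y\<in>K. P y = P xbar \<and> dist x y \<le> c * (P x - P xbar) powr \<beta>))"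

lemma deriv_desingularizing:
  fixes \<rho> \<alpha> s :: real
  assumes "0 < s"
  shows "deriv (\<lambda>s. \<rho> * s powr (1 - \<alpha>)) s = \<rho> * (1 - \<alpha>) / s powr \<alpha>"
proof -
  have "((\<lambda>s. \<rho> * s powr (1 - \<alpha>)) has_real_derivative \<rho> * ((1 - \<alpha>) * s powr (1 - \<alpha> - 1))) (at s)"
    using assms by (intro DERIV_cmult has_real_derivative_powr)
  then show ?thesis
    by (simp add: DERIV_imp_deriv powr_minus divide_inverse)
qed

text \<open>For a convex function, the extended-real formulation of the KL property comes down to a lower
  bound on the norm of every subgradient: dividing out the derivative of the desingularising function
  turns the constant \<open>\<rho>\<close> into \<open>c = 1 / (\<rho> * (1 - \<alpha>))\<close>, and points without subgradients satisfy both
  versions.\<close>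

lemma KL_exponent_convex_iff:
  fixes P :: "'a::euclidean_space \<Rightarrow> real"
  assumes P: "convex_on UNIV P" and K: "convex K" "closed K"
    and xbar: "xbar \<in> K" and min: "\<And>x. x \<in> K \<Longrightarrow> P xbar \<le> P x"
    and \<alpha>: "0 \<le> \<alpha>" "\<alpha> < 1"
  shows "KL_exponent (restrict_to P K) \<alpha> xbar \<longleftrightarrow> real_KL_inequality P K \<alpha> xbar"
proof -
  let ?f = "restrict_to P K"
  note lim = limiting_subdiff_convex[OF P K(1)]
  have proper: "proper_fun ?f"
    using xbar by (auto simp: proper_fun_def delta_fun_def intro!: exI[of _ xbar])
  have lsc: "lower_semicontinuous ?f"
    using convex_on_continuous[OF open_UNIV P] K by (intro lower_semicontinuous_restrict_to)
  have "0 \<in> limiting_subdiff ?f xbar"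
    using xbar min by (simp add: lim convex_subdiff_on_def)
  then have dom: "xbar \<in> dom_subdiff ?f"
    by (auto simp: dom_subdiff_def)
  show ?thesis
  proof
    assume "KL_exponent ?f \<alpha> xbar"
    then obtain r U \<rho> where r: "0 < r" and U: "xbar \<in> interior U" and \<rho>: "0 < (\<rho>::real)"
      and KL: "\<And>x. x \<in> U \<Longrightarrow> ?f xbar < ?f x \<Longrightarrow> ?f x < ?f xbar + r \<Longrightarrow>
         1 \<le> ereal (deriv (\<lambda>s. \<rho> * s powr (1 - \<alpha>)) (real_of_ereal (?f x - ?f xbar)))
               * edist_set 0 (limiting_subdiff ?f x)"
      unfolding KL_exponent_def by blast
    obtain \<epsilon> where \<epsilon>: "\<epsilon> > 0" "ball xbar \<epsilon> \<subseteq> U"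
      using U by (auto simp: mem_interior)
    obtain r' :: real where r': "r' > 0" "ereal r' \<le> r"
      using r by (metis ereal_dense2 ereal_less(2) less_imp_le)
    define c where "c = 1 / (\<rho> * (1 - \<alpha>))"
    have c: "c > 0" using \<rho> \<alpha> by (simp add: c_def)
    have "c * (P x - P xbar) powr \<alpha> \<le> norm v"
      if x: "x \<in> K" "dist x xbar < \<epsilon>" "P xbar < P x" "P x < P xbar + r'"
        and v: "v \<in> convex_subdiff_on K P x" for x v
    proof -
      define s where "s = P x - P xbar"
      have s: "s > 0" using x by (simp add: s_def)
      have "x \<in> U" using x \<epsilon> by (auto simp: dist_commute)
      moreover have "?f x < ?f xbar + r"
      proof -
        have "?f x < ereal (P xbar + r')" using x by simp
        also have "\<dots> \<le> ?f xbar + r"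
          using r'(2) xbar by (metis add_left_mono plus_ereal.simps(1) restrict_to_in)
        finally show ?thesis .
      qed
      ultimately have "1 \<le> ereal (\<rho> * (1 - \<alpha>) / s powr \<alpha>) * edist_set 0 (limiting_subdiff ?f x)"
        using KL[of x] x xbar s by (simp add: deriv_desingularizing flip: s_def)
      also have "\<dots> \<le> ereal (\<rho> * (1 - \<alpha>) / s powr \<alpha>) * ereal (norm v)"
      proof (rule ereal_mult_left_mono)
        show "edist_set 0 (limiting_subdiff ?f x) \<le> ereal (norm v)"
          unfolding edist_set_def using v x(1) by (intro INF_lower2[of v]) (auto simp: lim)
      qed (use s \<rho> \<alpha> in simp)
      finally have "1 \<le> \<rho> * (1 - \<alpha>) / s powr \<alpha> * norm v" by (simp add: one_ereal_def)
      then show ?thesis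
        using s \<rho> \<alpha> unfolding s_def[symmetric] c_def by (simp add: field_simps)
    qed
    then show "real_KL_inequality P K \<alpha> xbar"
      unfolding real_KL_inequality_def using \<epsilon>(1) r'(1) c by blast
  next
    assume "real_KL_inequality P K \<alpha> xbar"
    then obtain \<epsilon> r c where *: "\<epsilon> > 0" "r > 0" "c > 0"
      and KL: "\<And>x v. x \<in> K \<Longrightarrow> dist x xbar < \<epsilon> \<Longrightarrow> P xbar < P x \<Longrightarrow> P x < P xbar + r \<Longrightarrow>
        v \<in> convex_subdiff_on K P x \<Longrightarrow> c * (P x - P xbar) powr \<alpha> \<le> norm v"
      unfolding real_KL_inequality_def by blast
    define \<rho> where "\<rho> = 1 / (c * (1 - \<alpha>))"
    have \<rho>: "\<rho> > 0" "\<rho> * (1 - \<alpha>) = 1 / c" using * \<alpha> by (auto simp: \<rho>_def)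
    have "1 \<le> ereal (deriv (\<lambda>s. \<rho> * s powr (1 - \<alpha>)) (real_of_ereal (?f x - ?f xbar)))
               * edist_set 0 (limiting_subdiff ?f x)"
      if x: "x \<in> ball xbar \<epsilon>" "?f xbar < ?f x" "?f x < ?f xbar + ereal r" for x
    proof -
      have xK: "x \<in> K"
        using x(3) by (rule_tac ccontr) simp
      define s where "s = P x - P xbar"
      have s: "s > 0" "P x < P xbar + r" using x xK xbar by (auto simp: s_def)
      have "ereal (c * s powr \<alpha>) \<le> edist_set 0 (limiting_subdiff ?f x)"
        unfolding edist_set_def
        using KL[OF xK] x(1) s xK by (intro INF_greatest) (auto simp: lim s_def dist_commute)
      then have "ereal (1 / (c * s powr \<alpha>)) * ereal (c * s powr \<alpha>)
          \<le> ereal (1 / (c * s powr \<alpha>)) * edist_set 0 (limiting_subdiff ?f x)"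
        using * by (intro ereal_mult_left_mono) auto
      then have "1 \<le> ereal (1 / (c * s powr \<alpha>)) * edist_set 0 (limiting_subdiff ?f x)"
        using * s by (simp add: one_ereal_def)
      then show ?thesis
        using xK xbar s \<rho> by (simp add: deriv_desingularizing flip: s_def)
    qed
    moreover have "xbar \<in> interior (ball xbar \<epsilon>)" using * by simp
    ultimately show "KL_exponent ?f \<alpha> xbar"
      unfolding KL_exponent_def
      using proper lsc dom \<alpha> \<rho>(1) *(2)
      by (intro conjI exI[of _ "ereal r"] exI[of _ "ball xbar \<epsilon>"] exI[of _ \<rho>]) auto
  qed
qed

text \<open>A sandwich argument: the epigraph of \<open>P - P z\<close> lies above the open region below the concave cone
  \<open>- \<tau> * norm (w - z)\<close>, and both meet every neighbourhood of \<open>(z, 0)\<close>. A separating hyperplane therefore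
  passes through \<open>(z, 0)\<close>. It is not vertical, as the lower region projects onto the whole space, so it
  is the graph of an affine function. Lying below \<open>P\<close> makes its slope a subgradient, and lying above the
  cone bounds the slope by \<open>\<tau>\<close>.\<close>

lemma subgradient_of_cone_minorant:
  fixes P :: "'a::euclidean_space \<Rightarrow> real"
  assumes P: "convex_on K P" and z: "z \<in> K" and \<tau>: "0 \<le> \<tau>"
    and low: "\<And>w. w \<in> K \<Longrightarrow> P z - \<tau> * norm (w - z) \<le> P w"
  obtains v where "v \<in> convex_subdiff_on K P z" "norm v \<le> \<tau>"
proof -
  define A where "A = {(w, t). w \<in> K \<and> P w - P z \<le> t}"
  define B where "B = {(w, t). t < - \<tau> * norm (w - z)}"
  have "convex A"
    unfolding convex_alt
  proof (intro ballI allI impI)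
    fix p q and u :: real
    assume pq: "p \<in> A" "q \<in> A" and u: "0 \<le> u \<and> u \<le> 1"
    obtain w1 t1 w2 t2 where eq: "p = (w1, t1)" "q = (w2, t2)" by fastforce
    have K: "w1 \<in> K" "w2 \<in> K" and t: "P w1 - P z \<le> t1" "P w2 - P z \<le> t2"
      using pq by (auto simp: A_def eq)
    have "P ((1 - u) *\<^sub>R w1 + u *\<^sub>R w2) - P z \<le> (1 - u) * (P w1 - P z) + u * (P w2 - P z)"
      using convex_onD[OF P, of u w1 w2] u K by (simp add: algebra_simps)
    also have "\<dots> \<le> (1 - u) * t1 + u * t2"
      using u t by (intro add_mono mult_left_mono) auto
    finally show "(1 - u) *\<^sub>R p + u *\<^sub>R q \<in> A"
      using convex_on_imp_convex[OF P] K u by (auto simp: A_def eq convex_alt)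
  qed
  moreover have "convex B"
    unfolding convex_alt
  proof (intro ballI allI impI)
    fix p q and u :: real
    assume pq: "p \<in> B" "q \<in> B" and u: "0 \<le> u \<and> u \<le> 1"
    obtain w1 t1 w2 t2 where eq: "p = (w1, t1)" "q = (w2, t2)" by fastforce
    have t: "t1 + \<tau> * norm (w1 - z) < 0" "t2 + \<tau> * norm (w2 - z) < 0"
      using pq by (auto simp: B_def eq)
    have "(1 - u) *\<^sub>R w1 + u *\<^sub>R w2 - z = (1 - u) *\<^sub>R (w1 - z) + u *\<^sub>R (w2 - z)"
      by (simp add: algebra_simps)
    then have "norm ((1 - u) *\<^sub>R w1 + u *\<^sub>R w2 - z) \<le> (1 - u) * norm (w1 - z) + u * norm (w2 - z)"
      using norm_triangle_ineq[of "(1 - u) *\<^sub>R (w1 - z)" "u *\<^sub>R (w2 - z)"] u by simp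
    then have "\<tau> * norm ((1 - u) *\<^sub>R w1 + u *\<^sub>R w2 - z)
        \<le> \<tau> * ((1 - u) * norm (w1 - z) + u * norm (w2 - z))"
      using \<tau> by (rule mult_left_mono)
    moreover have "(1 - u) * (t1 + \<tau> * norm (w1 - z)) + u * (t2 + \<tau> * norm (w2 - z)) < 0"
      using u t convex_bound_lt[OF t, of "1 - u" u] by simp
    ultimately have "(1 - u) * t1 + u * t2 < - \<tau> * norm ((1 - u) *\<^sub>R w1 + u *\<^sub>R w2 - z)"
      by (simp add: algebra_simps)
    then show "(1 - u) *\<^sub>R p + u *\<^sub>R q \<in> B"
      by (simp add: B_def eq)
  qed
  moreover have zA: "(z, 0) \<in> A" using z by (simp add: A_def)
  moreover have "(z, -1) \<in> B" by (simp add: B_def)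
  moreover have "A \<inter> B = {}" using low by (fastforce simp: A_def B_def)
  ultimately obtain h b where h: "h \<noteq> 0" "\<And>p. p \<in> B \<Longrightarrow> h \<bullet> p \<le> b" "\<And>p. p \<in> A \<Longrightarrow> b \<le> h \<bullet> p"
    using separating_hyperplane_sets[of B A] by blast
  obtain a \<beta> where eq: "h = (a, \<beta>)" by fastforce
  have hA: "b \<le> a \<bullet> w + \<beta> * t" if "w \<in> K" "P w - P z \<le> t" for w t
    using h(3)[of "(w, t)"] that by (simp add: A_def eq)
  \<comment> \<open>The region \<open>B\<close> is open, so its separation inequality is extended to the boundary by a limit.\<close>
  have hB: "a \<bullet> w + \<beta> * (- \<tau> * norm (w - z)) \<le> b" for w
  proof (rule tendsto_upperbound)
    show "((\<lambda>e. a \<bullet> w + \<beta> * (- \<tau> * norm (w - z) - e)) \<longlongrightarrow> a \<bullet> w + \<beta> * (- \<tau> * norm (w - z)))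
        (at_right 0)"
      by (rule tendsto_eq_intros refl | simp)+
    show "\<forall>\<^sub>F e in at_right 0. a \<bullet> w + \<beta> * (- \<tau> * norm (w - z) - e) \<le> b"
      using h(2)[of "(w, t)" for t]
      by (intro eventually_at_rightI[of 0 1]) (auto simp: B_def eq)
  qed simp
  have b: "b = a \<bullet> z"
    using hA[of z 0] hB[of z] z by simp
  have "0 \<le> \<beta>"
    using hA[of z 1] z b by simp
  moreover have "\<beta> \<noteq> 0"
  proof
    assume "\<beta> = 0"
    then have "a \<noteq> 0" using h(1) eq by (simp add: zero_prod_def)
    then have "0 < a \<bullet> a" by simp
    moreover have "a \<bullet> (z + a) \<le> b" using hB[of "z + a"] \<open>\<beta> = 0\<close> by simp
    ultimately show False unfolding b inner_add_right by linarith
  qed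
  ultimately have \<beta>: "0 < \<beta>" by simp
  define v where "v = - (a /\<^sub>R \<beta>)"
  have av: "a = - (\<beta> *\<^sub>R v)" using \<beta> by (simp add: v_def)
  have "v \<in> convex_subdiff_on K P z"
    unfolding convex_subdiff_on_def
  proof (intro CollectI ballI)
    fix w assume "w \<in> K"
    then have "\<beta> * (v \<bullet> (w - z)) \<le> \<beta> * (P w - P z)"
      using hA[of w "P w - P z"] unfolding b av by (simp add: algebra_simps inner_diff_right)
    then show "P z + v \<bullet> (w - z) \<le> P w" using \<beta> by simp
  qed
  moreover have "norm v \<le> \<tau>"
  proof -
    have "\<beta> * (norm v * norm v) \<le> \<beta> * (\<tau> * norm v)"
      \<comment> \<open>Descending along \<open>v\<close> is the direction in which the cone bound is tightest.\<close>
      using hB[of "z - v"] unfolding b av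
      by (simp add: inner_diff_right dot_square_norm power2_eq_square algebra_simps)
    then show ?thesis
      using \<beta> \<tau> by (cases "v = 0") auto
  qed
  ultimately show thesis using that by blast
qed

text \<open>Concavity of \<open>t powr \<beta>\<close> on the half-line, including the endpoint \<open>0\<close>.\<close>

lemma powr_le_tangent:
  fixes a s \<beta> :: real
  assumes "0 \<le> a" "0 < s" "0 < \<beta>" "\<beta> \<le> 1"
  shows "a powr \<beta> \<le> s powr \<beta> + \<beta> * s powr (\<beta> - 1) * (a - s)"
proof -
  have eq: "s powr (\<beta> - 1) = s powr \<beta> / s" using assms by (simp add: powr_diff)
  have "(a / s) powr \<beta> \<le> 1 + \<beta> * (a / s - 1)"
  proof (cases "a = 0")
    case False
    then show ?thesis
      using Youngs_inequality_0[of \<beta> "1 - \<beta>" "a / s" 1] assms by (simp add: algebra_simps)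
  qed (use assms in simp)
  then have "s powr \<beta> * (a / s) powr \<beta> \<le> s powr \<beta> * (1 + \<beta> * (a / s - 1))"
    by (rule mult_left_mono) simp
  then show ?thesis
    using assms unfolding eq by (simp add: powr_divide field_simps)
qed

text \<open>Given \<open>x\<close>, let \<open>z\<close> minimise \<open>(P w - P xbar) powr (1 - \<alpha>) + \<theta> * norm (w - x)\<close> over \<open>K\<close>. Comparing
  with \<open>w = x\<close> bounds the distance from \<open>x\<close> to \<open>z\<close> as required, and so it remains to see that \<open>z\<close> lies
  in the solution set. Otherwise the power may be replaced by its tangent at \<open>s = P z - P xbar > 0\<close>,
  which lies above it by concavity and so keeps \<open>z\<close> minimal. The function \<open>P\<close> then decreases away from
  \<open>z\<close> with slope at most \<open>\<theta> / \<kappa>\<close>, where \<open>\<kappa>\<close> is the derivative of the power at \<open>s\<close>. This yields a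
  subgradient of norm at most \<open>\<theta> / \<kappa>\<close>, which is too short for the KL inequality if \<open>\<theta>\<close> is small.\<close>

lemma KL_imp_growth:
  fixes P :: "'a::euclidean_space \<Rightarrow> real"
  assumes P: "convex_on K P" "continuous_on K P" and K: "compact K"
    and min: "\<And>x. x \<in> K \<Longrightarrow> P xbar \<le> P x"
    and \<alpha>: "0 \<le> \<alpha>" "\<alpha> < 1" and KL: "real_KL_inequality P K \<alpha> xbar"
  shows "local_growth P K (1 - \<alpha>) xbar"
proof -
  define \<beta> where "\<beta> = 1 - \<alpha>"
  have \<beta>: "0 < \<beta>" "\<beta> \<le> 1" "\<alpha> = 1 - \<beta>" using \<alpha> by (auto simp: \<beta>_def)
  obtain \<epsilon> r c where *: "\<epsilon> > 0" "r > 0" "c > 0"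
    and KL: "\<And>x v. x \<in> K \<Longrightarrow> dist x xbar < \<epsilon> \<Longrightarrow> P xbar < P x \<Longrightarrow> P x < P xbar + r \<Longrightarrow>
        v \<in> convex_subdiff_on K P x \<Longrightarrow> c * (P x - P xbar) powr \<alpha> \<le> norm v"
    using KL unfolding real_KL_inequality_def by blast
  \<comment> \<open>The KL inequality would force \<open>\<theta> \<ge> c * \<beta>\<close>; half of that leaves a contradiction.\<close>
  define \<theta> where "\<theta> = c * \<beta> / 2"
  have \<theta>: "\<theta> > 0" using * \<beta> by (simp add: \<theta>_def)
  \<comment> \<open>Starting within \<open>\<epsilon> / 2\<close> of \<open>xbar\<close>, the minimiser moves by at most another \<open>\<epsilon> / 2\<close>.\<close>
  define r' where "r' = min r ((\<theta> * \<epsilon> / 2) powr (1 / \<beta>))"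
  have r': "r' > 0" "r' \<le> r" using * \<theta> by (auto simp: r'_def)
  have r'_powr: "r' powr \<beta> \<le> \<theta> * \<epsilon> / 2"
  proof -
    have "r' powr \<beta> \<le> ((\<theta> * \<epsilon> / 2) powr (1 / \<beta>)) powr \<beta>"
      using r' \<beta> by (intro powr_mono2) (auto simp: r'_def)
    also have "\<dots> = \<theta> * \<epsilon> / 2" using \<beta> \<theta> * by (simp add: powr_powr)
    finally show ?thesis .
  qed
  have "\<exists>y\<in>K. P y = P xbar \<and> dist x y \<le> 1 / \<theta> * (P x - P xbar) powr \<beta>"
    if x: "x \<in> K" "dist x xbar < \<epsilon> / 2" "P x < P xbar + r'" for x
  proof -
    define h where "h = (\<lambda>w. (P w - P xbar) powr \<beta> + \<theta> * norm (w - x))"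
    have "continuous_on K h"
      unfolding h_def using P(2) min \<beta>
      by (intro continuous_on_add continuous_on_powr' continuous_intros) auto
    then obtain z where z: "z \<in> K" "\<And>w. w \<in> K \<Longrightarrow> h z \<le> h w"
      using continuous_attains_inf[OF K, of h] x by blast
    have hzx: "(P z - P xbar) powr \<beta> + \<theta> * norm (z - x) \<le> (P x - P xbar) powr \<beta>"
      using z(2)[OF x(1)] by (simp add: h_def)
    have "\<theta> * norm (z - x) \<le> (P x - P xbar) powr \<beta>"
      using hzx powr_ge_zero[of "P z - P xbar" \<beta>] by linarith
    then have dist: "dist x z \<le> 1 / \<theta> * (P x - P xbar) powr \<beta>"
      using \<theta> by (simp add: dist_norm norm_minus_commute field_simps)
    have "(P x - P xbar) powr \<beta> \<le> r' powr \<beta>"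
      using x min[OF x(1)] \<beta> by (intro powr_mono2) auto
    then have "\<theta> * norm (z - x) \<le> \<theta> * (\<epsilon> / 2)"
      using r'_powr \<open>\<theta> * norm (z - x) \<le> _\<close> by simp
    then have near: "dist z xbar < \<epsilon>"
      using \<theta> x(2) dist_triangle[of z xbar x] by (simp add: dist_norm)
    have "P z = P xbar"
    proof (rule ccontr)
      assume "P z \<noteq> P xbar"
      define s where "s = P z - P xbar"
      have s: "s > 0" using min[OF z(1)] \<open>P z \<noteq> P xbar\<close> by (simp add: s_def)
      have "s powr \<beta> \<le> (P x - P xbar) powr \<beta>"
        using hzx \<theta> unfolding s_def by (smt (verit) mult_nonneg_nonneg norm_ge_zero)
      then have "P z \<le> P x"
        using min[OF x(1)] \<beta> s powr_less_mono2[of \<beta> "P x - P xbar" s] by (force simp: s_def)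
      define \<kappa> where "\<kappa> = \<beta> * s powr (\<beta> - 1)"
      have \<kappa>: "\<kappa> > 0" using s \<beta> by (simp add: \<kappa>_def)
      have "P z - \<theta> / \<kappa> * norm (w - z) \<le> P w" if w: "w \<in> K" for w
      proof -
        have "s powr \<beta> + \<theta> * norm (z - x) \<le> (P w - P xbar) powr \<beta> + \<theta> * norm (w - x)"
          using z(2)[OF w] by (simp add: h_def s_def)
        also have "(P w - P xbar) powr \<beta> \<le> s powr \<beta> + \<kappa> * (P w - P z)"
          using powr_le_tangent[of "P w - P xbar" s \<beta>] min[OF w] s \<beta> by (simp add: \<kappa>_def s_def)
        finally have "- \<kappa> * (P w - P z) \<le> \<theta> * (norm (w - x) - norm (z - x))"
          by (simp add: algebra_simps)
        also have "\<dots> \<le> \<theta> * norm (w - z)"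
          using \<theta> norm_triangle_ineq2[of "w - x" "z - x"] by (intro mult_left_mono) auto
        finally show ?thesis
          using \<kappa> by (simp add: field_simps)
      qed
      then obtain v where v: "v \<in> convex_subdiff_on K P z" "norm v \<le> \<theta> / \<kappa>"
        using subgradient_of_cone_minorant[OF P(1) z(1), of "\<theta> / \<kappa>"] \<theta> \<kappa> by auto
      have "c * s powr \<alpha> \<le> \<theta> / \<kappa>"
        using KL[OF z(1) near _ _ v(1)] v(2) s \<open>P z \<le> P x\<close> x(3) r' by (simp add: s_def)
      also have "\<theta> / \<kappa> = c * s powr \<alpha> / 2"
        using s \<beta> powr_minus_divide[of s \<alpha>] by (simp add: \<theta>_def \<kappa>_def)
      finally show False using s * by simp
    qed
    with z dist show ?thesis by blast
  qed
  then show ?thesis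
    unfolding local_growth_def \<beta>_def[symmetric] using * r' \<theta>
    by (intro exI[of _ "\<epsilon> / 2"] exI[of _ r'] exI[of _ "1 / \<theta>"] conjI ballI impI) auto
qed

text \<open>If \<open>y\<close> is a nearby point of \<open>K\<close> with \<open>P y = P xbar\<close>, then \<open>P x - P y \<le> v \<bullet> (x - y) \<le> norm v * dist x y\<close>; the growth bound
  on \<open>dist x y\<close> leaves the power \<open>\<alpha>\<close> of \<open>P x - P y\<close> to be absorbed by \<open>norm v\<close>.\<close>

lemma growth_imp_KL:
  fixes P :: "'a::real_inner \<Rightarrow> real"
  assumes growth: "local_growth P K (1 - \<alpha>) xbar"
  shows "real_KL_inequality P K \<alpha> xbar"
proof -
  obtain \<epsilon> r c where *: "\<epsilon> > 0" "r > 0" "c > 0"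
    and growth: "\<And>x. x \<in> K \<Longrightarrow> dist x xbar < \<epsilon> \<Longrightarrow> P x < P xbar + r \<Longrightarrow>
        \<exists>y\<in>K. P y = P xbar \<and> dist x y \<le> c * (P x - P xbar) powr (1 - \<alpha>)"
    using growth unfolding local_growth_def by blast
  have "1 / c * (P x - P xbar) powr \<alpha> \<le> norm v"
    if x: "x \<in> K" "dist x xbar < \<epsilon>" "P xbar < P x" "P x < P xbar + r"
      and v: "v \<in> convex_subdiff_on K P x" for x v
  proof -
    define s where "s = P x - P xbar"
    have s: "s > 0" using x by (simp add: s_def)
    obtain y where y: "y \<in> K" "P y = P xbar" "dist x y \<le> c * s powr (1 - \<alpha>)"
      using growth[OF x(1,2,4)] unfolding s_def by blast
    have "s \<le> v \<bullet> (x - y)"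
      using v y(1,2) by (auto simp: convex_subdiff_on_def s_def inner_diff_right algebra_simps
          dest!: bspec[of _ _ y])
    also have "\<dots> \<le> norm v * norm (x - y)" by (rule norm_cauchy_schwarz)
    also have "\<dots> \<le> norm v * (c * s powr (1 - \<alpha>))"
      using y(3) by (intro mult_left_mono) (auto simp: dist_norm)
    finally have "s powr \<alpha> * s \<le> norm v * c * (s powr \<alpha> * s powr (1 - \<alpha>))"
      using mult_left_mono[of s "norm v * (c * s powr (1 - \<alpha>))" "s powr \<alpha>"] by (simp add: ac_simps)
    also have "s powr \<alpha> * s powr (1 - \<alpha>) = s" using s by (simp flip: powr_add)
    finally show ?thesis using s * by (simp add: s_def[symmetric] field_simps)
  qed
  then show ?thesis
    unfolding real_KL_inequality_def using *
    by (intro exI[of _ \<epsilon>] exI[of _ r] exI[of _ "1 / c"] conjI ballI impI) auto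
qed

section \<open>Maxima of convex functions\<close>

lemma convex_on_Max:
  fixes f :: "'i \<Rightarrow> 'a::real_vector \<Rightarrow> real"
  assumes "finite I" "I \<noteq> {}" and f: "\<And>i. i \<in> I \<Longrightarrow> convex_on S (f i)"
  shows "convex_on S (\<lambda>x. Max ((\<lambda>i. f i x) ` I))"
proof (rule convex_onI)
  show "convex S" using assms convex_on_imp_convex by blast
  fix t x y assume t: "0 < (t::real)" "t < 1" and xy: "x \<in> S" "y \<in> S"
  show "Max ((\<lambda>i. f i ((1 - t) *\<^sub>R x + t *\<^sub>R y)) ` I)
      \<le> (1 - t) * Max ((\<lambda>i. f i x) ` I) + t * Max ((\<lambda>i. f i y) ` I)"
  proof (rule Max.boundedI)
    fix a assume "a \<in> (\<lambda>i. f i ((1 - t) *\<^sub>R x + t *\<^sub>R y)) ` I"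
    then obtain i where i: "i \<in> I" "a = f i ((1 - t) *\<^sub>R x + t *\<^sub>R y)" by blast
    have "a \<le> (1 - t) * f i x + t * f i y"
      using convex_onD[OF f[OF i(1)]] t xy i(2) by simp
    also have "\<dots> \<le> (1 - t) * Max ((\<lambda>i. f i x) ` I) + t * Max ((\<lambda>i. f i y) ` I)"
      using t i(1) assms(1) by (intro add_mono mult_left_mono) auto
    finally show "a \<le> (1 - t) * Max ((\<lambda>i. f i x) ` I) + t * Max ((\<lambda>i. f i y) ` I)" .
  qed (use assms in auto)
qed

lemma convex_on_positive_part:
  fixes f :: "'a::real_vector \<Rightarrow> real"
  assumes f: "convex_on S f"
  shows "convex_on S (\<lambda>x. max (f x) 0)"
proof (rule convex_onI)
  show "convex S" using f by (rule convex_on_imp_convex)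
  fix t x y assume t: "0 < (t::real)" "t < 1" and xy: "x \<in> S" "y \<in> S"
  have "f ((1 - t) *\<^sub>R x + t *\<^sub>R y) \<le> (1 - t) * f x + t * f y"
    using convex_onD[OF f] t xy by simp
  also have "\<dots> \<le> (1 - t) * max (f x) 0 + t * max (f y) 0"
    using t by (intro add_mono mult_left_mono) auto
  finally show "max (f ((1 - t) *\<^sub>R x + t *\<^sub>R y)) 0 \<le> (1 - t) * max (f x) 0 + t * max (f y) 0"
    using t by (intro max.boundedI add_nonneg_nonneg mult_nonneg_nonneg) auto
qed

lemma convex_sublevel:
  fixes f :: "'a::real_vector \<Rightarrow> real"
  assumes f: "convex_on UNIV f"
  shows "convex {x. f x \<le> b}"
  unfolding convex_alt
proof (intro ballI allI impI)
  fix x y and u :: real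
  assume "x \<in> {x. f x \<le> b}" "y \<in> {x. f x \<le> b}" "0 \<le> u \<and> u \<le> 1"
  then show "(1 - u) *\<^sub>R x + u *\<^sub>R y \<in> {x. f x \<le> b}"
    using convex_lower[OF f, of x y "1 - u" u] by simp
qed

lemma Max_positive_parts:
  fixes f :: "'i \<Rightarrow> real"
  assumes "finite I" "I \<noteq> {}"
  shows "Max ((\<lambda>i. max (f i) 0) ` I) = max (Max (f ` I)) 0"
proof -
  have "mono (\<lambda>t::real. max t 0)" by (auto intro!: monoI)
  then show ?thesis
    using assms mono_Max_commute[of "\<lambda>t::real. max t 0" "f ` I"] by (simp add: image_image)
qed

section \<open>From the constrained to the penalised problem\<close>

text \<open>A point \<open>x\<close> of \<open>C\<close> with violation \<open>\<gamma> = max (H x) 0\<close> is made feasible by moving the fraction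
  \<open>\<gamma> / (\<gamma> + \<delta>)\<close> of the way to a Slater point of slack \<open>\<delta>\<close>. This fraction is at most \<open>\<gamma> / \<delta>\<close>, so both the
  displacement and, by convexity, the increase of \<open>P\<close> are linear in the violation, with constants given
  by the boundedness of \<open>C\<close> and of \<open>P\<close> on \<open>C\<close>.\<close>

lemma Slater_retraction:
  fixes H :: "'a::real_normed_vector \<Rightarrow> real"
  assumes C: "convex C" "compact C" and H: "convex_on C H"
    and P: "convex_on C P" "continuous_on C P"
    and x0: "x0 \<in> C" "H x0 < 0"
  obtains B where "0 < B"
    "\<And>x. x \<in> C \<Longrightarrow> \<exists>y\<in>C. H y \<le> 0 \<and> dist x y \<le> B * max (H x) 0 \<and> P y \<le> P x + B * max (H x) 0"
proof -
  define \<delta> where "\<delta> = - H x0"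
  have \<delta>: "\<delta> > 0" using x0 by (simp add: \<delta>_def)
  obtain D where D: "\<And>x. x \<in> C \<Longrightarrow> norm x \<le> D"
    using compact_imp_bounded[OF C(2)] by (auto simp: bounded_iff)
  obtain L where L: "\<And>x. x \<in> C \<Longrightarrow> \<bar>P x\<bar> \<le> L"
    using compact_imp_bounded[OF compact_continuous_image[OF P(2) C(2)]] by (auto simp: bounded_iff)
  \<comment> \<open>Bounds both the diameter of \<open>C\<close> and the oscillation of \<open>P\<close>; the \<open>1\<close> keeps it positive.\<close>
  define M where "M = 1 + 2 * D + 2 * L"
  have DL: "0 \<le> D" "0 \<le> L"
    using D[OF x0(1)] L[OF x0(1)] norm_ge_zero[of x0] abs_ge_zero[of "P x0"] by linarith+
  then have M: "M > 0" by (simp add: M_def)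
  have "\<exists>y\<in>C. H y \<le> 0 \<and> dist x y \<le> M / \<delta> * max (H x) 0 \<and> P y \<le> P x + M / \<delta> * max (H x) 0"
    if x: "x \<in> C" for x
  proof -
    define \<gamma> where "\<gamma> = max (H x) 0"
    define t where "t = \<gamma> / (\<gamma> + \<delta>)"
    have \<gamma>: "\<gamma> \<ge> 0" "H x \<le> \<gamma>" by (auto simp: \<gamma>_def)
    have t: "0 \<le> t" "t \<le> 1" "t \<le> \<gamma> / \<delta>"
      using \<gamma> \<delta> by (auto simp: t_def intro!: divide_left_mono)
    have tM: "t * b \<le> M / \<delta> * \<gamma>" if "b \<le> M" for b
    proof -
      have "t * b \<le> \<gamma> / \<delta> * M"
        using t \<gamma> M that by (meson mult_left_mono mult_right_mono order_trans less_imp_le)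
      then show ?thesis by (simp add: ac_simps)
    qed
    define y where "y = x + t *\<^sub>R (x0 - x)"
    have y: "y \<in> C" "H y \<le> H x + t * (H x0 - H x)" "P y \<le> P x + t * (P x0 - P x)"
      using convex_on_along_segment[OF H x x0(1) t(1,2)]
        convex_on_along_segment[OF P(1) x x0(1) t(1,2)] by (auto simp: y_def)
    have "(1 - t) * H x \<le> (1 - t) * \<gamma>"
      using \<gamma> t by (intro mult_left_mono) auto
    then have "H y \<le> (1 - t) * \<gamma> - t * \<delta>"
      using y(2) by (simp add: \<delta>_def algebra_simps)
    also have "\<dots> = 0"
      using \<gamma> \<delta> by (simp add: t_def field_simps)
    finally have "H y \<le> 0" .
    moreover have "dist x y \<le> M / \<delta> * \<gamma>"
    proof -
      have "dist x y = t * norm (x0 - x)" using t by (simp add: y_def dist_norm)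
      moreover have "norm (x0 - x) \<le> M"
        using norm_triangle_ineq4[of x0 x] D[OF x] D[OF x0(1)] DL by (simp add: M_def)
      ultimately show ?thesis using tM by simp
    qed
    moreover have "P y \<le> P x + M / \<delta> * \<gamma>"
    proof -
      have "P x0 - P x \<le> M"
        using L[OF x] L[OF x0(1)] DL unfolding M_def by linarith
      from tM[OF this] show ?thesis using y(3) by simp
    qed
    ultimately show ?thesis
      using y(1) unfolding \<gamma>_def by blast
  qed
  then show thesis using that[of "M / \<delta>"] M \<delta> by simp
qed

text \<open>Write \<open>s\<close> for the excess of the penalised objective at \<open>x\<close> over its minimum. As \<open>xbar\<close> already
  minimises with the smaller parameter \<open>\<eta>0\<close>, the surplus penalty \<open>(\<eta> - \<eta>0) * max (H x) 0\<close> is at most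
  \<open>s\<close>; this is where \<open>\<eta> > \<eta>0\<close> is used. Hence the violation at \<open>x\<close> is of order \<open>s\<close>, the retraction
  yields a feasible point within order \<open>s\<close> whose objective excess is again of order \<open>s\<close>, and growth at
  that point reaches a solution within order \<open>s powr \<beta>\<close>. For \<open>s \<le> 1\<close> the linear terms are dominated by
  this power, as \<open>\<beta> \<le> 1\<close>.\<close>

lemma growth_penalty:
  fixes P H :: "'a::real_normed_vector \<Rightarrow> real"
  assumes B: "0 < B"
      "\<And>x. x \<in> C \<Longrightarrow> \<exists>y\<in>C. H y \<le> 0 \<and> dist x y \<le> B * max (H x) 0 \<and> P y \<le> P x + B * max (H x) 0"
    and \<eta>: "0 < \<eta>0" "\<eta>0 < \<eta>"
    and min0: "\<And>x. x \<in> C \<Longrightarrow> P xbar \<le> P x + \<eta>0 * max (H x) 0"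
    and xbar: "H xbar \<le> 0"
    and \<beta>: "0 < \<beta>" "\<beta> \<le> 1"
    and growth: "local_growth P (C \<inter> {x. H x \<le> 0}) \<beta> xbar"
  shows "local_growth (\<lambda>x. P x + \<eta> * max (H x) 0) C \<beta> xbar"
proof -
  obtain \<epsilon> r c where *: "\<epsilon> > 0" "r > 0" "c > 0"
    and feasible_growth: "\<forall>x\<in>C \<inter> {x. H x \<le> 0}. dist x xbar < \<epsilon> \<longrightarrow> P x < P xbar + r \<longrightarrow>
        (\<exists>y\<in>C \<inter> {x. H x \<le> 0}. P y = P xbar \<and> dist x y \<le> c * (P x - P xbar) powr \<beta>)"
    using growth unfolding local_growth_def by blast
  define b where "b = B / (\<eta> - \<eta>0)"
  have b: "b > 0" using B \<eta> by (simp add: b_def)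
  \<comment> \<open>The three bounds give \<open>s \<le> s powr \<beta>\<close>, keep the retracted point within \<open>\<epsilon>\<close> of \<open>xbar\<close>, and keep
    its objective excess below \<open>r\<close>.\<close>
  define r' where "r' = Min {1, \<epsilon> / (2 * b), r / (1 + b)}"
  have r': "r' > 0" "r' \<le> 1" "b * r' \<le> \<epsilon> / 2" "(1 + b) * r' \<le> r"
  proof -
    show "r' > 0" "r' \<le> 1" using b * by (auto simp: r'_def)
    have "r' \<le> \<epsilon> / (2 * b)" "r' \<le> r / (1 + b)" by (auto simp: r'_def)
    then show "b * r' \<le> \<epsilon> / 2" "(1 + b) * r' \<le> r"
      using b by (auto simp: field_simps)
  qed
  let ?Q = "\<lambda>x. P x + \<eta> * max (H x) 0"
  define c' where "c' = b + c * (1 + b) powr \<beta>"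
  have c': "c' > 0" using b * by (simp add: c'_def add_pos_nonneg)
  have "\<exists>u\<in>C. ?Q u = ?Q xbar \<and> dist x u \<le> c' * (?Q x - ?Q xbar) powr \<beta>"
    if x: "x \<in> C" "dist x xbar < \<epsilon> / 2" "?Q x < ?Q xbar + r'" for x
  proof -
    define s where "s = ?Q x - P xbar"
    have Qxbar: "?Q xbar = P xbar" using xbar by simp
    have "(\<eta> - \<eta>0) * max (H x) 0 \<le> s"
      using min0[OF x(1)] by (simp add: s_def left_diff_distrib)
    then have \<gamma>: "max (H x) 0 \<le> s / (\<eta> - \<eta>0)"
      using \<eta> by (metis diff_gt_0_iff_gt mult.commute pos_le_divide_eq)
    have "0 \<le> (\<eta> - \<eta>0) * max (H x) 0" using \<eta> by (intro mult_nonneg_nonneg) auto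
    then have s: "0 \<le> s" "s < r'"
      using \<open>_ \<le> s\<close> x(3) Qxbar by (linarith, simp add: s_def)
    have Bs: "B * max (H x) 0 \<le> b * s"
      using mult_left_mono[OF \<gamma>, of B] B(1) by (simp add: b_def)
    obtain y where y: "y \<in> C" "H y \<le> 0" "dist x y \<le> b * s" "P y \<le> P x + b * s"
      using B(2)[OF x(1)] Bs by (meson add_left_mono order_trans)
    have "P x \<le> ?Q x" using \<eta> by simp
    then have Py: "P y - P xbar \<le> (1 + b) * s"
      using y(4) by (simp add: s_def algebra_simps)
    have Py0: "0 \<le> P y - P xbar"
      using min0[OF y(1)] y(2) by simp
    have "b * s < b * r'" "(1 + b) * s < (1 + b) * r'" using s b by auto
    then have "dist y xbar < \<epsilon>" "P y < P xbar + r"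
      using y(3) Py r' x(2) dist_triangle[of y xbar x] by (auto simp: dist_commute)
    then obtain u where u: "u \<in> C" "H u \<le> 0" "P u = P xbar" "dist y u \<le> c * (P y - P xbar) powr \<beta>"
      using feasible_growth y(1,2) by blast
    have "c * (P y - P xbar) powr \<beta> \<le> c * ((1 + b) * s) powr \<beta>"
      using Py Py0 * \<beta> by (intro mult_left_mono powr_mono2) auto
    also have "\<dots> = c * (1 + b) powr \<beta> * s powr \<beta>"
      using b s by (simp add: powr_mult)
    finally have "dist y u \<le> c * (1 + b) powr \<beta> * s powr \<beta>" using u(4) by simp
    moreover have "s \<le> s powr \<beta>"
      using s r' \<beta> powr_mono'[of \<beta> 1 s] by simp
    then have "dist x y \<le> b * s powr \<beta>"
      using y(3) b by (meson less_imp_le mult_left_mono order_trans)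
    ultimately have "dist x u \<le> c' * s powr \<beta>"
      using dist_triangle[of x u y] by (simp add: c'_def algebra_simps)
    then show ?thesis
      using u Qxbar by (intro bexI[of _ u]) (auto simp: s_def)
  qed
  then show ?thesis
    unfolding local_growth_def using * r'(1) c'
    by (intro exI[of _ "\<epsilon> / 2"] exI[of _ r'] exI[of _ c'] conjI ballI impI) auto
qed

lemma Arg_min_restrict_to:
  assumes "K \<noteq> {}"
  shows "x \<in> Arg_min (restrict_to P K) \<longleftrightarrow> x \<in> K \<and> (\<forall>w\<in>K. P x \<le> P w)"
proof
  assume *: "x \<in> Arg_min (restrict_to P K)"
  then have le: "restrict_to P K x \<le> restrict_to P K w" for w
    by (auto simp: Arg_min_def is_arg_min_def not_less)
  obtain k where "k \<in> K" using assms by blast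
  then have "x \<in> K" using le[of k] by (cases "x \<in> K") auto
  moreover have "P x \<le> P w" if "w \<in> K" for w
    using le[of w] that \<open>x \<in> K\<close> by simp
  ultimately show "x \<in> K \<and> (\<forall>w\<in>K. P x \<le> P w)" by blast
next
  assume *: "x \<in> K \<and> (\<forall>w\<in>K. P x \<le> P w)"
  have "restrict_to P K x \<le> restrict_to P K w" for w
    using * by (cases "w \<in> K") auto
  then show "x \<in> Arg_min (restrict_to P K)"
    by (simp add: Arg_min_def is_arg_min_def not_less)
qed

theorem theorem5p1:
  fixes P1 :: "real ^ 'n \<Rightarrow> real"
    and C :: "(real ^ 'n) set"
    and g :: "nat \<Rightarrow> real ^ 'n \<Rightarrow> real"
    and m :: nat
    and xbar :: "real ^ 'n"
    and \<eta>bar \<alpha> :: real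
  assumes "convex_on UNIV P1"
    and "compact C" and "convex C"
    and "1 \<le> m"
    and "\<And>i. i \<in> {1..m} \<Longrightarrow> convex_on UNIV (g i)"
    and "C \<inter> {x. Max ((\<lambda>i. g i x) ` {1..m}) < 0} \<noteq> {}"
    and "xbar \<in> Arg_min (Fhat P1 C g m)"
    and "exact_penalty_parameter (Fhat P1 C g m) (Fhat_pen P1 C g m) \<eta>bar"
    and "0 < \<alpha>" and "\<alpha> < 1"
    and "KL_exponent (Fhat P1 C g m) \<alpha> xbar"
  shows "\<forall>\<eta>>\<eta>bar. KL_exponent (Fhat_pen P1 C g m \<eta>) \<alpha> xbar"
proof (intro allI impI)
  fix \<eta> assume \<eta>: "\<eta>bar < \<eta>"
  define H where "H = (\<lambda>x. Max ((\<lambda>i. g i x) ` {1..m}))"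
  have I: "finite {1..m}" "{1..m} \<noteq> {}" using assms(4) by auto
  have H: "convex_on UNIV H"
    unfolding H_def by (rule convex_on_Max[OF I assms(5)])
  have contH: "continuous_on UNIV H" and contP: "continuous_on UNIV P1"
    using convex_on_continuous[OF open_UNIV] H assms(1) by auto
  let ?pen = "\<lambda>\<eta> x. P1 x + \<eta> * max (H x) 0"
  define K where "K = C \<inter> {x. H x \<le> 0}"
  have feas: "feasible_set g m = {x. H x \<le> 0}"
    using I by (auto simp: feasible_set_def H_def)
  have F: "Fhat P1 C g m = restrict_to P1 K"
    by (auto simp: Fhat_def feas K_def delta_fun_def fun_eq_iff)
  have Fpen: "Fhat_pen P1 C g m \<eta> = restrict_to (?pen \<eta>) C" for \<eta>
    unfolding Fhat_pen_def Max_positive_parts[OF I] H_def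
    by (auto simp: delta_fun_def fun_eq_iff)
  obtain x0 where x0: "x0 \<in> C" "H x0 < 0" using assms(6) by (auto simp: H_def)
  then have ne: "K \<noteq> {}" "C \<noteq> {}" by (auto simp: K_def intro: less_imp_le)
  have "closed {x. H x \<le> 0}"
    by (intro closed_Collect_le contH continuous_intros)
  then have K: "compact K" "convex K"
    using assms(2,3) convex_sublevel[OF H]
    by (auto simp: K_def compact_Int_closed intro!: convex_Int)
  have convP: "convex_on S P1" and convH: "convex_on S H" if "convex S" for S
    using that convex_on_subset assms(1) H by blast+
  have xbar: "xbar \<in> K" "\<And>x. x \<in> K \<Longrightarrow> P1 xbar \<le> P1 x"
    using assms(7) unfolding F Arg_min_restrict_to[OF ne(1)] by auto
  have xbarC: "xbar \<in> C" "H xbar \<le> 0" using xbar by (auto simp: K_def)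
  have \<eta>bar: "0 < \<eta>bar" and same: "\<And>\<eta>. \<eta> \<ge> \<eta>bar \<Longrightarrow> Arg_min (Fhat_pen P1 C g m \<eta>) = Arg_min (Fhat P1 C g m)"
    using assms(8) by (auto simp: exact_penalty_parameter_def)
  have min_pen: "?pen \<eta>' xbar \<le> ?pen \<eta>' x" if "\<eta>' \<ge> \<eta>bar" "x \<in> C" for \<eta>' x
    using assms(7) that Arg_min_restrict_to[OF ne(2), of xbar "?pen \<eta>'"] same[OF that(1)] Fpen by auto
  have "real_KL_inequality P1 K \<alpha> xbar"
    using assms(9-11) KL_exponent_convex_iff[OF assms(1) K(2) compact_imp_closed[OF K(1)] xbar]
    by (simp add: F)
  then have "local_growth P1 K (1 - \<alpha>) xbar"
    using assms(9,10) xbar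
    by (intro KL_imp_growth convP K continuous_on_subset[OF contP]) auto
  moreover obtain B where "0 < B"
    "\<And>x. x \<in> C \<Longrightarrow> \<exists>y\<in>C. H y \<le> 0 \<and> dist x y \<le> B * max (H x) 0 \<and> P1 y \<le> P1 x + B * max (H x) 0"
    using Slater_retraction[OF assms(3,2) convH convP continuous_on_subset[OF contP] x0] assms(3)
    by blast
  ultimately have "local_growth (?pen \<eta>) C (1 - \<alpha>) xbar"
    using min_pen[of \<eta>bar] xbarC \<eta>bar \<eta> assms(9,10)
    by (intro growth_penalty[of B C H P1 \<eta>bar]) (auto simp: K_def)
  then have "real_KL_inequality (?pen \<eta>) C \<alpha> xbar"
    by (rule growth_imp_KL)
  moreover have "convex_on UNIV (?pen \<eta>)"
    using \<eta> \<eta>bar by (intro convex_on_add convex_on_cmul assms(1) convex_on_positive_part[OF H]) auto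
  ultimately show "KL_exponent (Fhat_pen P1 C g m \<eta>) \<alpha> xbar"
    unfolding Fpen
    using KL_exponent_convex_iff[of "?pen \<eta>" C xbar \<alpha>, OF _ assms(3) compact_imp_closed[OF assms(2)]
        xbarC(1) min_pen[OF less_imp_le[OF \<eta>]] less_imp_le[OF assms(9)] assms(10)]
    by blast
qed

end
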